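(* Let $D$ be the formal derivative with respect to the context-free grammar $u \rightarrow v^2,\ v \rightarrow v$, acting on rational functions in the indeterminates $u,v$. Then \[ \mathrm{Gen}(u^{-1}v,t)=\frac{v}{u\cosh(t)+(v^2-u)\sinh(t)}. \]
   Context: The formal derivative $D$ with respect to the grammar is the unique linear operator on rational functions in $u,v$ satisfying $D(u)=v^2$, $D(v)=v$ and the Leibniz rule $D(fg)=D(f)g+fD(g)$ (hence $D(f^{-1})=-f^{-2}D(f)$). For a formal function $w$, $\mathrm{Gen}(w,t)=\sum_{n\geq 0}D^n(w)\frac{t^n}{n!}$, a formal power series in $t$ whose coefficients are rational functions in $u,v$; the identity is an identity of such formal power series. *)

theory Defs
  imports "HOL-Computational_Algebra.Computational_Algebra"
begin

instance fract :: ("{idom, ring_char_0}") field_char_0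
proof
  show "inj (of_nat :: nat \<Rightarrow> 'a fract)"
    by (rule injI) (simp add: of_nat_fract eq_fract)
qed

(* K(u,v), as the field of fractions of K[u][v]. *)
type_synonym 'a ratfun = "'a poly poly fract"

definition ratfun_const :: "'a::field_char_0 \<Rightarrow> 'a ratfun" where
  "ratfun_const c = to_fract [:[:c:]:]"

definition ratfun_u :: "'a::field_char_0 ratfun" where
  "ratfun_u = to_fract [:[:0, 1:]:]"

definition ratfun_v :: "'a::field_char_0 ratfun" where
  "ratfun_v = to_fract [:0, 1:]"

definition is_formal_derivative ::
  "'a::field_char_0 ratfun \<Rightarrow> 'a ratfun \<Rightarrow> ('a ratfun \<Rightarrow> 'a ratfun) \<Rightarrow> bool" where
  "is_formal_derivative p q D \<longleftrightarrow>
     (\<forall>f g. D (f + g) = D f + D g) \<and>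
     (\<forall>c f. D (ratfun_const c * f) = ratfun_const c * D f) \<and>
     (\<forall>f g. D (f * g) = D f * g + f * D g) \<and>
     D ratfun_u = p \<and> D ratfun_v = q"

(* The formal derivative with respect to the grammar u -> p, v -> q. The description is
   proper: see ex1_formal_derivative below. *)
definition formal_derivative ::
  "'a::field_char_0 ratfun \<Rightarrow> 'a ratfun \<Rightarrow> 'a ratfun \<Rightarrow> 'a ratfun" where
  "formal_derivative p q = (THE D. is_formal_derivative p q D)"

definition Gen :: "('b::field_char_0 \<Rightarrow> 'b) \<Rightarrow> 'b \<Rightarrow> 'b fps" where
  "Gen D w = Abs_fps (\<lambda>n. (D ^^ n) w / fact n)"

(* cosh(c t) and sinh(c t) as formal power series in t. *)
definition fps_cosh :: "'b::field_char_0 \<Rightarrow> 'b fps" where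
  "fps_cosh c = fps_const (1 / 2) * (fps_exp c + fps_exp (- c))"

definition fps_sinh :: "'b::field_char_0 \<Rightarrow> 'b fps" where
  "fps_sinh c = fps_const (1 / 2) * (fps_exp c - fps_exp (- c))"


subsection \<open>Existence and uniqueness of the formal derivative\<close>

lemma map_pderiv_pCons:
  "map_poly pderiv (pCons c p) = pCons (pderiv c) (map_poly pderiv p)"
  for c :: "'a::field_char_0 poly"
  by (intro poly_eqI) (simp add: coeff_map_poly coeff_pCons split: nat.split)

lemma map_pderiv_add:
  "map_poly pderiv (p + q) = map_poly pderiv p + map_poly pderiv q"
  for p :: "'a::field_char_0 poly poly"
  by (intro poly_eqI) (simp add: coeff_map_poly pderiv_add)

lemma map_pderiv_smult:
  "map_poly pderiv (smult c q) = smult (pderiv c) q + smult c (map_poly pderiv q)"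
  for c :: "'a::field_char_0 poly"
  by (intro poly_eqI) (simp add: coeff_map_poly pderiv_mult algebra_simps)

lemma map_pderiv_mult:
  "map_poly pderiv (p * q) = map_poly pderiv p * q + p * map_poly pderiv q"
  for p :: "'a::field_char_0 poly poly"
proof (induction p)
  case 0
  then show ?case by simp
next
  case (pCons c p)
  then show ?case
    by (simp add: map_pderiv_pCons map_pderiv_add map_pderiv_smult algebra_simps)
qed

lemma derivation_extends_to_fract:
  fixes d :: "'r::idom \<Rightarrow> 'r fract"
  assumes add: "\<And>a b. d (a + b) = d a + d b"
    and mult: "\<And>a b. d (a * b) = d a * to_fract b + to_fract a * d b"
  obtains D where "\<And>f g. D (f + g) = D f + D g"
    and "\<And>f g. D (f * g) = D f * g + f * D g"
    and "\<And>a. D (to_fract a) = d a"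
proof -
  define rep where "rep f = (SOME (a, b). b \<noteq> 0 \<and> f = to_fract a / to_fract b)"
    for f :: "'r fract"
  define D where "D f = (case rep f of (a, b) \<Rightarrow>
      (d a * to_fract b - to_fract a * d b) / (to_fract b)\<^sup>2)" for f
  have d1: "d 1 = 0"
  proof -
    have "d 1 + 0 = d 1 + d 1"
      using mult[of 1 1] by (simp only: mult_1_right mult_1_left to_fract_1 add_0_right)
    then show ?thesis
      by (simp only: add_left_cancel)
  qed
  have ex: "\<exists>a b. b \<noteq> 0 \<and> f = to_fract a / to_fract b" for f :: "'r fract"
    by (cases f) (auto simp: to_fract_def)
  have D: "D (to_fract a / to_fract b) =
      (d a * to_fract b - to_fract a * d b) / (to_fract b)\<^sup>2" if b: "b \<noteq> 0" for a b
  proof -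
    obtain a' b' where r: "rep (to_fract a / to_fract b) = (a', b')"
      by fastforce
    have "case rep (to_fract a / to_fract b) of (a', b') \<Rightarrow>
        b' \<noteq> 0 \<and> to_fract a / to_fract b = to_fract a' / to_fract b'"
      unfolding rep_def by (rule someI[of _ "(a, b)"]) (use b in simp)
    then have b': "b' \<noteq> 0" and eq: "to_fract a / to_fract b = to_fract a' / to_fract b'"
      by (auto simp: r)
    have nz: "to_fract b \<noteq> 0" "to_fract b' \<noteq> 0"
      using b b' by auto
    have e1: "to_fract a * to_fract b' = to_fract a' * to_fract b"
      using eq nz by (simp add: field_simps)
    then have "to_fract (a * b') = to_fract (a' * b)"
      by simp
    then have "a * b' = a' * b"
      by (simp only: to_fract_eq_iff)
    then have e2: "d a * to_fract b' + to_fract a * d b' = d a' * to_fract b + to_fract a' * d b"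
      using mult[of a b'] mult[of a' b] by simp
    have a': "to_fract a' = to_fract a * to_fract b' / to_fract b"
      using e1 nz by (simp add: field_simps)
    have da': "d a' = (d a * to_fract b' + to_fract a * d b' - to_fract a' * d b) / to_fract b"
      using e2 nz by (simp add: field_simps)
    show ?thesis
      unfolding D_def r prod.case da' a' using nz
      by (simp add: field_simps power2_eq_square)
  qed
  show thesis
  proof
    fix f g :: "'r fract"
    obtain a b where f: "b \<noteq> 0" "f = to_fract a / to_fract b" using ex by blast
    obtain a' b' where g: "b' \<noteq> 0" "g = to_fract a' / to_fract b'" using ex by blast
    have nz: "to_fract b \<noteq> 0" "to_fract b' \<noteq> 0" "b * b' \<noteq> 0"
      using f g by auto
    have s: "f + g = to_fract (a * b' + a' * b) / to_fract (b * b')"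
      using nz f g by (simp add: field_simps)
    show "D (f + g) = D f + D g"
      unfolding s D[OF nz(3)] unfolding f g D[OF f(1)] D[OF g(1)] mult add
      using nz(1,2) by (simp add: field_simps power2_eq_square)
    have p: "f * g = to_fract (a * a') / to_fract (b * b')"
      unfolding f g by simp
    show "D (f * g) = D f * g + f * D g"
      unfolding p D[OF nz(3)] unfolding f g D[OF f(1)] D[OF g(1)] mult add
      using nz(1,2) by (simp add: field_simps power2_eq_square)
  next
    fix a :: 'r
    show "D (to_fract a) = d a"
      using D[of 1 a] by (simp add: d1)
  qed
qed

lemma ex_formal_derivative: "\<exists>D. is_formal_derivative p q D"
proof -
  define d where "d P = p * to_fract (map_poly pderiv P) + q * to_fract (pderiv P)"
    for P :: "'a poly poly"
  have add: "d (a + b) = d a + d b" for a b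
    by (simp add: d_def map_pderiv_add pderiv_add algebra_simps)
  have mult: "d (a * b) = d a * to_fract b + to_fract a * d b" for a b
    by (simp add: d_def map_pderiv_mult pderiv_mult algebra_simps)
  obtain D where D: "\<And>f g. D (f + g) = D f + D g"
    "\<And>f g. D (f * g) = D f * g + f * D g" "\<And>a. D (to_fract a) = d a"
    using derivation_extends_to_fract[of d, OF add mult] by blast
  have c: "D (ratfun_const c) = 0" for c
    by (simp add: ratfun_const_def D(3) d_def map_pderiv_pCons pderiv_pCons)
  have u: "D ratfun_u = p"
    by (simp add: ratfun_u_def D(3) d_def map_pderiv_pCons pderiv_pCons flip: one_pCons)
  have v: "D ratfun_v = q"
    by (simp add: ratfun_v_def D(3) d_def map_pderiv_pCons pderiv_pCons)
      (simp flip: one_pCons)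
  have "is_formal_derivative p q D"
    unfolding is_formal_derivative_def using D(1,2) c u v by simp
  then show ?thesis by blast
qed

lemma formal_derivative_unique:
  fixes D E :: "'a::field_char_0 ratfun \<Rightarrow> 'a ratfun"
  assumes "is_formal_derivative p q D" "is_formal_derivative p q E"
  shows "D = E"
proof
  fix f :: "'a ratfun"
  have add: "D (f + g) = D f + D g" "E (f + g) = E f + E g"
    and hom: "D (ratfun_const c * f) = ratfun_const c * D f"
      "E (ratfun_const c * f) = ratfun_const c * E f"
    and mult: "D (f * g) = D f * g + f * D g" "E (f * g) = E f * g + f * E g"
    and uv: "D ratfun_u = E ratfun_u" "D ratfun_v = E ratfun_v" for f g c
    using assms unfolding is_formal_derivative_def by auto
  have one: "D 1 = 0" "E 1 = 0"
    using mult(1)[of 1 1] mult(2)[of 1 1] by auto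
  have zero: "D 0 = 0" "E 0 = 0"
    using add(1)[of 0 0] add(2)[of 0 0] by auto
  have const: "D (ratfun_const c) = E (ratfun_const c)" for c
    using hom(1)[of c 1] hom(2)[of c 1] one by simp
  have inner: "D (to_fract [:P:]) = E (to_fract [:P:])" for P :: "'a poly"
  proof (induction P)
    case 0
    then show ?case by (simp add: zero)
  next
    case (pCons c P)
    have "[:pCons c P:] = [:[:c:]:] + [:[:0, 1:]:] * [:P:]"
      by simp
    then have "to_fract [:pCons c P:] = ratfun_const c + ratfun_u * to_fract [:P:]"
      unfolding ratfun_const_def ratfun_u_def by (simp only: to_fract_add to_fract_mult)
    then show ?case
      by (simp only: add mult const uv pCons.IH)
  qed
  have poly: "D (to_fract P) = E (to_fract P)" for P :: "'a poly poly"
  proof (induction P)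
    case 0
    then show ?case by (simp add: zero)
  next
    case (pCons c P)
    have "pCons c P = [:c:] + [:0, 1:] * P"
      by simp
    then have "to_fract (pCons c P) = to_fract [:c:] + ratfun_v * to_fract P"
      unfolding ratfun_v_def by (simp only: to_fract_add to_fract_mult)
    then show ?case
      by (simp only: add mult inner uv pCons.IH)
  qed
  obtain a b where f: "f = Fract a b" "b \<noteq> 0"
    by (cases f)
  then have b: "to_fract b \<noteq> 0" and fb: "f * to_fract b = to_fract a"
    by (simp_all add: to_fract_def eq_fract Zero_fract_def)
  have "D f * to_fract b + f * D (to_fract b) = E f * to_fract b + f * E (to_fract b)"
    using mult[of f "to_fract b"] poly[of a] by (simp add: fb)
  then show "D f = E f"
    using b by (simp add: poly)
qed

lemma ex1_formal_derivative: "\<exists>!D. is_formal_derivative p q D"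
  using ex_formal_derivative formal_derivative_unique by blast

lemma is_formal_derivative_formal_derivative:
  "is_formal_derivative p q (formal_derivative p q)"
  unfolding formal_derivative_def by (rule theI'[OF ex1_formal_derivative])

end

theory Submission
  imports Defs
begin

text \<open>By the Leibniz rule, \<open>Gen D\<close> is multiplicative, so \<open>Gen(v/u) \<cdot> Gen(u) = Gen(v) = v e\<^sup>t\<close>.
  Since \<open>2u - v\<^sup>2\<close> is a constant of \<open>D\<close>, \<open>2 Gen(u) = 2u - v\<^sup>2 + v\<^sup>2 e\<^sup>2\<^sup>t\<close>; hence the
  denominator of the claim is \<open>e\<^sup>-\<^sup>t Gen(u)\<close>.\<close>

text \<open>Working over an arbitrary field of characteristic zero keeps the fraction-field
  construction out of the power series argument.\<close>

locale field_derivation =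
  fixes D :: "'b::field_char_0 \<Rightarrow> 'b"
  assumes add: "D (f + g) = D f + D g"
    and mult: "D (f * g) = D f * g + f * D g"
begin

lemma zero: "D 0 = 0"
  using add[of 0 0] by simp

lemma funpow_add: "(D ^^ n) (f + g) = (D ^^ n) f + (D ^^ n) g"
  by (induction n) (simp_all add: add)

lemma Gen_add: "Gen D (f + g) = Gen D f + Gen D g"
  by (rule fps_ext) (simp add: Gen_def funpow_add add_divide_distrib)

text \<open>Differentiating in \<open>t\<close> shifts the coefficients, and the factor
  \<open>n + 1\<close> cancels against the factorial, so \<open>D\<close> acts as
  \<open>d/dt\<close>.\<close>

lemma fps_deriv_Gen: "fps_deriv (Gen D f) = Gen D (D f)"
proof (rule fps_ext)
  fix n
  have "of_nat (Suc n) \<noteq> (0 :: 'b)"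
    by (simp only: of_nat_eq_0_iff)
  then show "fps_deriv (Gen D f) $ n = Gen D (D f) $ n"
    by (simp add: Gen_def funpow_swap1 field_simps del: of_nat_Suc)
qed

text \<open>Both sides obey the same product rule under \<open>d/dt\<close> and agree at
  \<open>t = 0\<close>. Induction on the coefficient index thus replaces the binomial Leibniz
  formula.\<close>

lemma Gen_mult: "Gen D (f * g) = Gen D f * Gen D g"
proof (rule fps_ext)
  fix n
  show "Gen D (f * g) $ n = (Gen D f * Gen D g) $ n"
  proof (induction n arbitrary: f g)
    case 0
    show ?case by (simp add: Gen_def)
  next
    case (Suc n)
    have nz: "of_nat (Suc n) \<noteq> (0 :: 'b)"
      by (simp only: of_nat_eq_0_iff)
    have "of_nat (Suc n) * Gen D (f * g) $ Suc n = Gen D (D (f * g)) $ n"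
      by (simp flip: fps_deriv_Gen)
    also have "\<dots> = (Gen D (D f) * Gen D g + Gen D f * Gen D (D g)) $ n"
      \<comment> \<open>The induction hypothesis is used for the pairs \<open>D f, g\<close> and
        \<open>f, D g\<close>, hence the generalisation over both factors.\<close>
      by (simp add: mult Gen_add Suc.IH)
    also have "\<dots> = fps_deriv (Gen D f * Gen D g) $ n"
      by (simp add: fps_deriv_Gen algebra_simps)
    also have "\<dots> = of_nat (Suc n) * (Gen D f * Gen D g) $ Suc n"
      by (simp only: fps_deriv_nth Suc_eq_plus1)
    finally show ?case
      using nz by (simp only: mult_cancel_left simp_thms)
  qed
qed

lemma Gen_constant:
  assumes "D c = 0"
  shows "Gen D c = fps_const c"
proof -
  have "(D ^^ n) c = (if n = 0 then c else 0)" for n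
    by (induction n) (simp_all add: assms zero)
  then show ?thesis
    by (intro fps_ext) (simp add: Gen_def)
qed

lemma Gen_eigenvector:
  assumes "D v = v"
  shows "Gen D v = fps_const v * fps_exp 1"
proof -
  have "(D ^^ n) v = v" for n
    by (induction n) (simp_all add: assms)
  then show ?thesis
    by (intro fps_ext) (simp add: Gen_def)
qed

lemma Gen_quotient:
  assumes u: "D u = v\<^sup>2" and v: "D v = v" and nz: "u \<noteq> 0"
  shows "Gen D (inverse u * v) =
    fps_const v / (fps_const u * fps_cosh 1 + fps_const (v\<^sup>2 - u) * fps_sinh 1)"
    (is "?W = _ / ?den")
proof -
  define c where "c = u + u - v * v"
  define U V E F where "U = fps_const u" and "V = fps_const v"
    and "E = fps_exp (1 :: 'b)" and "F = fps_exp (- 1 :: 'b)"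
  have uu: "u + u = c + v * v"
    by (simp add: c_def)
  \<comment> \<open>Applying \<open>D\<close> to \<open>uu\<close> yields \<open>D c\<close> from
    additivity alone, without a rule for differences.\<close>
  have "D c + D (v * v) = D u + D u"
    unfolding add[symmetric] uu ..
  then have "D c = 0"
    by (simp add: mult u v power2_eq_square)
  then have Gc: "Gen D c = U + U - V * V"
    by (simp add: Gen_constant U_def V_def c_def)
  have Gv: "Gen D v = V * E"
    by (simp add: Gen_eigenvector v V_def E_def)
  have Gu: "Gen D u + Gen D u = U + U - V * V + V * E * (V * E)"
    using arg_cong[OF uu, of "Gen D"] by (simp only: Gen_add Gen_mult Gc Gv)
  have EF: "E * F = 1"
    unfolding E_def F_def by (simp flip: fps_exp_add_mult)
  have half: "fps_const (1 / 2 :: 'b) + fps_const (1 / 2) = 1"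
    by (simp flip: fps_const_1_eq_1)
  have "?den = fps_const (1 / 2) * (U * (E + F) + (V * V - U) * (E - F))"
    by (simp add: fps_cosh_def fps_sinh_def U_def V_def E_def F_def power2_eq_square
        algebra_simps flip: fps_const_sub fps_const_mult)
  \<comment> \<open>The \<open>U * E\<close> terms cancel, leaving \<open>2UF - VVF + VVE\<close>;
    on the right, \<open>F * E * E\<close> collapses to \<open>E\<close>.\<close>
  also have "U * (E + F) + (V * V - U) * (E - F) = F * (Gen D u + Gen D u)"
    unfolding Gu using EF by algebra
  also have "fps_const (1 / 2) * \<dots> = F * Gen D u"
    using half by algebra
  finally have den: "?den = F * Gen D u" .
  have "inverse u * v * u = v"
    using nz by simp
  then have "?W * Gen D u = V * E"
    by (simp only: Gen_mult[symmetric] Gv)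
  then have "?W * ?den = V"
    unfolding den using EF by algebra
  \<comment> \<open>At \<open>t = 0\<close>, cosh is 1 and sinh is 0. The denominator is therefore
    nonzero and can be cancelled.\<close>
  moreover have "?den $ 0 = u"
    by (simp add: fps_cosh_def fps_sinh_def)
  then have "?den \<noteq> 0"
    using nz by (metis fps_zero_nth)
  ultimately show ?thesis
    unfolding V_def by (metis nonzero_mult_div_cancel_right)
qed

end

theorem theorem4p4:
  "Gen (formal_derivative (ratfun_v\<^sup>2) ratfun_v)
      (inverse ratfun_u * ratfun_v :: 'a::field_char_0 ratfun) =
    fps_const ratfun_v /
      (fps_const ratfun_u * fps_cosh 1 + fps_const (ratfun_v\<^sup>2 - ratfun_u) * fps_sinh 1)"
proof -
  let ?D = "formal_derivative (ratfun_v\<^sup>2) ratfun_v :: 'a ratfun \<Rightarrow> _"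
  have D: "is_formal_derivative (ratfun_v\<^sup>2) ratfun_v ?D"
    by (rule is_formal_derivative_formal_derivative)
  interpret field_derivation ?D
    using D by unfold_locales (simp_all add: is_formal_derivative_def)
  show ?thesis
    by (rule Gen_quotient) (use D in \<open>simp_all add: is_formal_derivative_def ratfun_u_def\<close>)
qed

end
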